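(* Let $n\ge1$, let $x_1,\dots,x_{2n}$ be real and distinct, and let $\boldsymbol\zeta=\{\zeta_1,\dots,\zeta_{n+1}\}\subset\widehat{\mathbb C}$ be distinct and closed under complex conjugation. Define $$\boldsymbol\rho_j=\sum_{k\ne j}2\delta_{x_k}-\sum_{k=1}^{n+1}4\delta_{\zeta_k},\qquad j=1,\dots,2n.$$ Then for any $\boldsymbol\nu$-superposition of the $\mathrm{SLE}(0,x_j,\boldsymbol\rho_j)$ processes, the quantity $$N_t(z):=g_t'(z)\,\frac{\prod_{j=1}^{2n}(g_t(z)-x_j(t))}{\prod_{\zeta_k\ne\infty}(g_t(z)-g_t(\zeta_k))^2}$$ is an integral of motion (constant in $t$) on the interval $[0,\tau_z\wedge\tau)$, for each $z\in\overline{\mathbb H}$.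
   Context: $\mathbb H$ is the upper half-plane, $\widehat{\mathbb C}$ the Riemann sphere. Convention at infinity: one of the $\zeta_k$ may be $\infty$; fractions whose denominator involves $\infty$ equal $0$. $\boldsymbol\nu$-superposition: given measurable $\nu_1,\dots,\nu_{2n}:[0,\infty)\to[0,\infty)$, the $\boldsymbol\nu$-superposition of the $\mathrm{SLE}(0,x_j,\boldsymbol\rho_j)$ processes with $\boldsymbol\rho_j$ as in the claim is the Loewner chain $$\partial_tg_t(z)=\sum_{j=1}^{2n}\frac{2\nu_j(t)}{g_t(z)-x_j(t)},\qquad g_0(z)=z,$$ where, with $\zeta_k(t)=g_t(\zeta_k)$, the driving functions solve $$\dot x_j=\nu_j\Big(\sum_{k\ne j}\frac{2}{x_j-x_k}-\sum_{k=1}^{n+1}\frac{4}{x_j-\zeta_k(t)}\Big)+\sum_{k\ne j}\frac{2\nu_k}{x_j-x_k},\qquad x_j(0)=x_j .$$ Here $'$ is the derivative in $z$; $\tau_z$ is the first time at which $g_t(z)=x_j(t)$ for some $j$; $\tau$ is the first time at which two of the $x_j(t)$ collide or some $x_j(t)$ collides with some $g_t(\zeta_k)$. (If $z=\zeta_k$ for some $k$, then $N_t(z)$ is understood as the value $\infty$.) *)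

theory Defs
  imports "HOL-Complex_Analysis.Complex_Analysis"
begin

text \<open>
  Points of the Riemann sphere are elements of \<open>complex option\<close>, with \<open>None\<close> for the point at
  infinity. A map of the plane acts on the sphere through \<^const>\<open>map_option\<close>, thus fixing infinity.
\<close>

text \<open>The fraction \<open>1 / (a - w)\<close>, which is 0 for infinite \<open>w\<close>.\<close>

definition recip_diff :: "complex \<Rightarrow> complex option \<Rightarrow> complex" where
  "recip_diff a w = (case w of None \<Rightarrow> 0 | Some v \<Rightarrow> 1 / (a - v))"

text \<open>Infinite if the event never occurs.\<close>

definition first_time :: "(real \<Rightarrow> bool) \<Rightarrow> ereal" where
  "first_time P = (INF t\<in>{t. 0 \<le> t \<and> P t}. ereal t)"

text \<open>
  Since the \<open>\<nu>\<^sub>j\<close> are only measurable, a differential equation \<open>y' = f\<close> is understood in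
  Caratheodory's sense: on \<open>[0,T)\<close>, the function \<open>y\<close> is a Lebesgue primitive of \<open>f\<close>.
\<close>

definition solves_until :: "ereal \<Rightarrow> (real \<Rightarrow> complex) \<Rightarrow> (real \<Rightarrow> complex) \<Rightarrow> bool" where
  "solves_until T y f \<longleftrightarrow>
     (\<forall>t. 0 \<le> t \<and> ereal t < T \<longrightarrow>
        f absolutely_integrable_on {0..t} \<and> (f has_integral (y t - y 0)) {0..t})"

text \<open>
  Below, \<open>x j t\<close> is \<open>x\<^sub>j(t)\<close> for \<open>j \<in> {1..m}\<close>, \<open>\<zeta> k\<close> is the initial position of the \<open>k\<close>-th marked
  point for \<open>k \<in> {1..l}\<close>, and \<open>g t z\<close> is \<open>g\<^sub>t(z)\<close>. The maps \<open>g t\<close> are total functions on the plane;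
  their values at \<open>z\<close> are meaningful up to the time \<open>\<tau>\<^sub>z\<close> only.
\<close>

definition hits :: "nat \<Rightarrow> (nat \<Rightarrow> real \<Rightarrow> real) \<Rightarrow> (real \<Rightarrow> complex \<Rightarrow> complex) \<Rightarrow> complex \<Rightarrow> real \<Rightarrow> bool" where
  "hits m x g z t \<longleftrightarrow> (\<exists>j\<in>{1..m}. g t z = complex_of_real (x j t))"

definition swallowing_time ::
  "nat \<Rightarrow> (nat \<Rightarrow> real \<Rightarrow> real) \<Rightarrow> (real \<Rightarrow> complex \<Rightarrow> complex) \<Rightarrow> complex \<Rightarrow> ereal" where
  "swallowing_time m x g z = first_time (hits m x g z)"

definition collision_time ::
  "nat \<Rightarrow> nat \<Rightarrow> (nat \<Rightarrow> complex option) \<Rightarrow> (nat \<Rightarrow> real \<Rightarrow> real) \<Rightarrow>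
     (real \<Rightarrow> complex \<Rightarrow> complex) \<Rightarrow> ereal" where
  "collision_time m l \<zeta> x g = first_time (\<lambda>t.
     (\<exists>j\<in>{1..m}. \<exists>k\<in>{1..m}. j \<noteq> k \<and> x j t = x k t) \<or>
     (\<exists>j\<in>{1..m}. \<exists>k\<in>{1..l}. map_option (g t) (\<zeta> k) = Some (complex_of_real (x j t))))"

text \<open>
  The chain is started from every point of the plane, so that it also moves marked points in the
  lower half-plane and so that the complex derivative of \<open>g t\<close> makes sense at real points. The last
  clause says that \<open>\<tau>\<^sub>z\<close>, if it precedes \<open>T\<close>, is a time at which the trajectory of \<open>z\<close> really runs
  into a driving point: without it, an arbitrary value of the total function \<open>g\<close> could end the
  trajectory prematurely.
\<close>

definition loewner_chain_until ::
  "ereal \<Rightarrow> nat \<Rightarrow> (nat \<Rightarrow> real \<Rightarrow> real) \<Rightarrow> (nat \<Rightarrow> real \<Rightarrow> real) \<Rightarrow>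
     (real \<Rightarrow> complex \<Rightarrow> complex) \<Rightarrow> bool" where
  "loewner_chain_until T m \<nu> x g \<longleftrightarrow>
     (\<forall>z. g 0 z = z \<and>
        solves_until (min (swallowing_time m x g z) T) (\<lambda>t. g t z)
          (\<lambda>t. \<Sum>j=1..m. 2 * complex_of_real (\<nu> j t) / (g t z - complex_of_real (x j t))) \<and>
        (\<forall>t\<ge>0. ereal t = swallowing_time m x g z \<and> ereal t < T \<longrightarrow>
           hits m x g z t \<and> continuous (at t within {0..t}) (\<lambda>s. g s z)))"

text \<open>
  The right-hand side of the equation for \<open>x\<^sub>j\<close>. The factor of \<open>\<nu>\<^sub>j\<close> is the pairing of \<open>1 / (x\<^sub>j - \<cdot>)\<close>
  with the divisor \<open>\<rho>\<^sub>j\<close>, each of whose points has been moved to its position at time \<open>t\<close>.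
\<close>

definition driving_field ::
  "nat \<Rightarrow> (nat \<Rightarrow> complex option) \<Rightarrow> (nat \<Rightarrow> real \<Rightarrow> real) \<Rightarrow> (nat \<Rightarrow> real \<Rightarrow> real) \<Rightarrow>
     (real \<Rightarrow> complex \<Rightarrow> complex) \<Rightarrow> nat \<Rightarrow> real \<Rightarrow> complex" where
  "driving_field n \<zeta> \<nu> x g j t =
     complex_of_real (\<nu> j t) *
       ((\<Sum>k\<in>{1..2*n} - {j}. complex_of_real (2 / (x j t - x k t))) -
        (\<Sum>k=1..n+1. 4 * recip_diff (complex_of_real (x j t)) (map_option (g t) (\<zeta> k)))) +
     (\<Sum>k\<in>{1..2*n} - {j}. complex_of_real (2 * \<nu> k t / (x j t - x k t)))"

definition nu_superposition ::
  "nat \<Rightarrow> (nat \<Rightarrow> real) \<Rightarrow> (nat \<Rightarrow> complex option) \<Rightarrow> (nat \<Rightarrow> real \<Rightarrow> real) \<Rightarrow>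
     (nat \<Rightarrow> real \<Rightarrow> real) \<Rightarrow> (real \<Rightarrow> complex \<Rightarrow> complex) \<Rightarrow> bool" where
  "nu_superposition n x0 \<zeta> \<nu> x g \<longleftrightarrow>
     (let \<tau> = collision_time (2*n) (n+1) \<zeta> x g in
        loewner_chain_until \<tau> (2*n) \<nu> x g \<and>
        (\<forall>j\<in>{1..2*n}. x j 0 = x0 j \<and>
           solves_until \<tau> (\<lambda>t. complex_of_real (x j t)) (driving_field n \<zeta> \<nu> x g j)))"

definition motion_integral ::
  "nat \<Rightarrow> (nat \<Rightarrow> complex option) \<Rightarrow> (nat \<Rightarrow> real \<Rightarrow> real) \<Rightarrow>
     (real \<Rightarrow> complex \<Rightarrow> complex) \<Rightarrow> real \<Rightarrow> complex \<Rightarrow> complex option" where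
  "motion_integral n \<zeta> x g t z =
     (if Some z \<in> \<zeta> ` {1..n+1} then None
      else Some (deriv (g t) z *
        (\<Prod>j=1..2*n. g t z - complex_of_real (x j t)) /
        (\<Prod>k\<in>{k\<in>{1..n+1}. \<zeta> k \<noteq> None}. (g t z - g t (the (\<zeta> k)))\<^sup>2)))"

end

theory Submission imports Defs begin

text \<open>
  Each factor of \<open>N\<^sub>t(z)\<close> solves a scalar linear equation \<open>y' = b y\<close> with integrable \<open>b\<close>, hence
  equals its initial value times \<open>exp (\<integral> b)\<close>; the logarithmic derivatives then cancel pointwise. For
  \<open>g\<^sub>t(w) - g\<^sub>t(z)\<close> the coefficient is
  \<open>b = - (\<Sum>j. 2 \<nu>\<^sub>j / ((g\<^sub>t(w) - x\<^sub>j) (g\<^sub>t(z) - x\<^sub>j)))\<close>, and letting \<open>w\<close> tend to \<open>z\<close> gives both the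
  existence of \<open>g\<^sub>t'(z)\<close> and its formula.
\<close>

text \<open>Two facts behind these formulas are not given: that each speed is integrable in time,
  and that \<open>g t\<close> is complex differentiable at \<open>z\<close>. Only the velocities are
  integrable by hypothesis. The speeds enter them with complex weights, so cancellation could a
  priori hide a speed that is not integrable. A second moment, whose velocity is a nonzero multiple
  of the sum of the speeds, excludes this. Integrable speeds then give a bound uniform in
  \<open>w\<close> near \<open>z\<close>, which the limit \<open>w\<close> to \<open>z\<close>
  needs. Before that, all such \<open>w\<close> must be shown to survive as long as \<open>z\<close>
  does. The final cancellation is a partial fraction identity: the weights 2 between driving points
  and -4 at the marks match the exponents 1 and -2 of the factors. Working with exponentials avoids
  any choice of a branch of the logarithm.\<close>

lemma ereal_less_first_timeD:
  assumes "ereal t < first_time P" "0 \<le> s" "s \<le> t"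
  shows "\<not> P s"
proof
  assume "P s"
  then have "first_time P \<le> ereal s"
    unfolding first_time_def using assms by (intro INF_lower) auto
  with assms show False
    by (meson ereal_less_eq(3) leD order_trans)
qed

lemma first_time_nonneg: "0 \<le> first_time P"
  unfolding first_time_def by (intro INF_greatest) auto

lemma continuous_on_mult_absolutely_integrable:
  fixes f g :: "real \<Rightarrow> complex"
  assumes "continuous_on {a..b} f" "g absolutely_integrable_on {a..b}"
  shows "(\<lambda>s. f s * g s) absolutely_integrable_on {a..b}"
proof (rule absolutely_integrable_bounded_measurable_product[where h="(*)"])
  show "bilinear ((*) :: complex \<Rightarrow> complex \<Rightarrow> complex)"
    by (simp add: bilinear_conv_bounded_bilinear bounded_bilinear_mult)
  show "f \<in> borel_measurable (lebesgue_on {a..b})"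
    using assms by (intro continuous_imp_measurable_on_sets_lebesgue) auto
  show "bounded (f ` {a..b})"
    by (intro compact_imp_bounded compact_continuous_image assms compact_Icc)
qed (use assms in auto)

subsection \<open>Linear equations with integrable coefficients\<close>

text \<open>The interval is cut at equally spaced levels of \<open>\<phi>\<close> instead of equally
  spaced times. Each of the N+1 pieces contributes at most \<open>C * (L / (N+1))\<^sup>2\<close>,
  so the total increment is at most \<open>C * L\<^sup>2 / (N+1)\<close>, which tends to 0.
  Continuity of \<open>\<phi>\<close> ensures that every level is attained.\<close>

lemma constant_if_quadratic_variation:
  fixes h :: "real \<Rightarrow> complex" and \<phi> :: "real \<Rightarrow> real"
  assumes ab: "a \<le> b" and \<phi>: "continuous_on {a..b} \<phi>" "mono_on {a..b} \<phi>" and C: "0 \<le> C"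
    and h: "\<And>s t. a \<le> s \<Longrightarrow> s \<le> t \<Longrightarrow> t \<le> b \<Longrightarrow> norm (h t - h s) \<le> C * (\<phi> t - \<phi> s)\<^sup>2"
  shows "h b = h a"
proof -
  define L where "L = \<phi> b - \<phi> a"
  have L: "0 \<le> L"
    using \<phi>(2) ab by (auto simp: L_def mono_on_def)
  have bound: "norm (h b - h a) \<le> C * L\<^sup>2 * inverse (real (Suc N))" for N
  proof -
    define lev where "lev i = \<phi> a + real i * L / real (Suc N)" for i
    have lev_Suc: "lev (Suc i) = lev i + L / real (Suc N)" for i
      by (simp add: lev_def add_divide_distrib distrib_right)
    have "\<exists>t. a \<le> t \<and> t \<le> b \<and> \<phi> t = lev i \<and> norm (h t - h a) \<le> real i * (C * (L / real (Suc N))\<^sup>2)"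
      if "i \<le> Suc N" for i
      using that
    proof (induction i)
      case 0
      then show ?case using ab by (intro exI[of _ a]) (auto simp: lev_def)
    next
      case (Suc i)
      then obtain t where t: "a \<le> t" "t \<le> b" "\<phi> t = lev i"
        "norm (h t - h a) \<le> real i * (C * (L / real (Suc N))\<^sup>2)" by auto
      have "lev (Suc i) \<le> \<phi> a + L"
        using Suc.prems L by (auto simp: lev_def field_simps mult_left_mono)
      then have "\<phi> t \<le> lev (Suc i)" "lev (Suc i) \<le> \<phi> b"
        using t L by (auto simp: lev_Suc L_def)
      then obtain u where u: "t \<le> u" "u \<le> b" "\<phi> u = lev (Suc i)"
        using IVT'[of \<phi> t "lev (Suc i)" b] t continuous_on_subset[OF \<phi>(1), of "{t..b}"] by auto
      have "norm (h u - h t) \<le> C * (L / real (Suc N))\<^sup>2"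
        using h[of t u] t u by (simp add: lev_Suc)
      moreover have "norm (h u - h a) \<le> norm (h u - h t) + norm (h t - h a)"
        by (metis norm_triangle_ineq diff_add_cancel add_diff_eq)
      ultimately have "norm (h u - h a) \<le> real (Suc i) * (C * (L / real (Suc N))\<^sup>2)"
        using t by (simp add: algebra_simps)
      then show ?case using u t by (intro exI[of _ u]) auto
    qed
    from this[of "Suc N"] obtain t where t: "a \<le> t" "t \<le> b" "\<phi> t = \<phi> b"
      "norm (h t - h a) \<le> real (Suc N) * (C * (L / real (Suc N))\<^sup>2)"
      by (auto simp: lev_def L_def)
    \<comment> \<open>The last level may be attained before \<open>b\<close>; from there on
      \<open>\<phi>\<close> does not grow, so the quadratic bound leaves no room for
      \<open>h\<close> to move.\<close>
    then have "h b = h t"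
      using h[of t b] by simp
    then show ?thesis
      using t(4) by (simp add: power2_eq_square field_simps del: of_nat_Suc)
  qed
  have "(\<lambda>N. C * L\<^sup>2 * inverse (real (Suc N))) \<longlonglongrightarrow> C * L\<^sup>2 * 0"
    by (intro tendsto_intros LIMSEQ_inverse_real_of_nat)
  then have "norm (h b - h a) \<le> C * L\<^sup>2 * 0"
    by (rule LIMSEQ_le_const) (use bound in auto)
  then show ?thesis by simp
qed

lemma has_integral_continuous_on:
  fixes y f :: "real \<Rightarrow> complex"
  assumes T: "0 \<le> T" and y: "\<And>t. t \<in> {0..T} \<Longrightarrow> (f has_integral (y t - y 0)) {0..t}"
  shows "continuous_on {0..T} y"
proof -
  have "continuous_on {0..T} (\<lambda>t. y 0 + integral {0..t} f)"
    using y[of T] T by (intro continuous_intros indefinite_integral_continuous_1) auto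
  then show ?thesis
  proof (rule continuous_on_eq)
    fix t assume "t \<in> {0..T}"
    from integral_unique[OF y[OF this]] show "y 0 + integral {0..t} f = y t" by simp
  qed
qed

text \<open>
  With a merely integrable \<open>b\<close> there is no pointwise chain rule for \<open>exp (\<integral> b)\<close>. Instead,
  \<open>y exp (- \<integral> b)\<close> has increments that are quadratic in those of \<open>\<integral> \<bar>b\<bar>\<close>.
\<close>

lemma linear_ode_exp:
  fixes y b :: "real \<Rightarrow> complex"
  assumes T: "0 \<le> T" and b: "b absolutely_integrable_on {0..T}"
    and y: "\<And>t. t \<in> {0..T} \<Longrightarrow> ((\<lambda>s. b s * y s) has_integral (y t - y 0)) {0..t}"
    and t: "t \<in> {0..T}"
  shows "y t = y 0 * exp (integral {0..t} b)"
proof -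
  define B where "B s = integral {0..s} b" for s
  define \<phi> where "\<phi> s = integral {0..s} (\<lambda>u. norm (b u))" for s
  define L where "L = \<phi> T"
  have nb: "(\<lambda>u. norm (b u)) integrable_on {0..T}" and ib: "b integrable_on {0..T}"
    using b by (auto simp: absolutely_integrable_on_def)
  have cy: "continuous_on {0..T} y"
    using T y by (rule has_integral_continuous_on)
  have "compact {0..T}" by simp
  then obtain M where M: "0 \<le> M" "\<And>s. s \<in> {0..T} \<Longrightarrow> norm (y s) \<le> M"
    using continuous_on_compact_bound[OF _ cy] by metis
  have c\<phi>: "continuous_on {0..T} \<phi>"
    unfolding \<phi>_def by (rule indefinite_integral_continuous_1[OF nb])
  have sub: "(\<lambda>u. norm (b u)) integrable_on {s..u}" "b integrable_on {s..u}" 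
     "(\<lambda>r. b r * y r) integrable_on {s..u}" if "0 \<le> s" "u \<le> T" for s u
    using integrable_subinterval_real[OF nb, of s u] integrable_subinterval_real[OF ib, of s u] that
      integrable_subinterval_real[OF has_integral_integrable[OF y[of T]], of s u] T by auto
  have \<phi>_diff: "\<phi> u - \<phi> s = integral {s..u} (\<lambda>u. norm (b u))" and B_diff: "B u - B s = integral {s..u} b"
    and y_diff: "y u - y s = integral {s..u} (\<lambda>r. b r * y r)"
    if "0 \<le> s" "s \<le> u" "u \<le> T" for s u
  proof -
    show "\<phi> u - \<phi> s = integral {s..u} (\<lambda>u. norm (b u))"
      unfolding \<phi>_def using Henstock_Kurzweil_Integration.integral_combine[OF that(1,2) sub(1)] that by (simp add: algebra_simps)
    show "B u - B s = integral {s..u} b"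
      unfolding B_def using Henstock_Kurzweil_Integration.integral_combine[OF that(1,2) sub(2)] that by (simp add: algebra_simps)
    have "integral {0..s} (\<lambda>r. b r * y r) = y s - y 0" "integral {0..u} (\<lambda>r. b r * y r) = y u - y 0"
      using y that by (auto simp: integral_unique)
    moreover have "integral {s..u} (\<lambda>r. b r * y r) = integral {0..u} (\<lambda>r. b r * y r) - integral {0..s} (\<lambda>r. b r * y r)"
      using Henstock_Kurzweil_Integration.integral_combine[OF that(1,2) sub(3)] that
      by (metis add_diff_cancel_left' order_refl)
    ultimately show "y u - y s = integral {s..u} (\<lambda>r. b r * y r)" by simp
  qed
  have \<phi>_mono: "\<phi> s \<le> \<phi> u" if "0 \<le> s" "s \<le> u" "u \<le> T" for s u
    using \<phi>_diff[OF that] integral_nonneg[OF sub(1)[of s u]] that by auto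
  have \<phi>0: "\<phi> 0 = 0" "B 0 = 0" by (auto simp: \<phi>_def B_def)
  have \<phi>_le: "0 \<le> \<phi> s" "\<phi> s \<le> L" if "s \<in> {0..T}" for s
    using \<phi>_mono[of 0 s] \<phi>_mono[of s T] that \<phi>0 by (auto simp: L_def)
  have B_le: "norm (B u - B s) \<le> \<phi> u - \<phi> s" if "0 \<le> s" "s \<le> u" "u \<le> T" for s u
    unfolding \<phi>_diff[OF that] B_diff[OF that] using that
    by (intro Henstock_Kurzweil_Integration.integral_norm_bound_integral sub) auto
  have y_le: "norm (y u - y s) \<le> M * (\<phi> u - \<phi> s)" if "0 \<le> s" "s \<le> u" "u \<le> T" for s u
  proof -
    have "norm (integral {s..u} (\<lambda>r. b r * y r)) \<le> integral {s..u} (\<lambda>r. M * norm (b r))"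
      using that M
      by (intro Henstock_Kurzweil_Integration.integral_norm_bound_integral sub integrable_on_mult_right)
        (auto simp: norm_mult mult.commute[of _ "norm (b _)"] intro!: mult_left_mono)
    then show ?thesis
      by (simp add: \<phi>_diff[OF that] y_diff[OF that])
  qed
  \<comment> \<open>Freezing \<open>y\<close> at its value at time \<open>s\<close> changes the
    integrand by at most \<open>norm (b r)\<close> times the increment of \<open>y\<close>, which is
    itself linear in the increment of \<open>\<phi>\<close>. Integrating yields the square.\<close>
  have y_quad: "norm (y u - y s - y s * (B u - B s)) \<le> M * (\<phi> u - \<phi> s)\<^sup>2"
    if su: "0 \<le> s" "s \<le> u" "u \<le> T" for s u
  proof -
    have "((\<lambda>r. b r * y r - b r * y s) has_integral (y u - y s - (B u - B s) * y s)) {s..u}"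
      unfolding y_diff[OF su] B_diff[OF su] using su
      by (intro has_integral_diff has_integral_mult_left integrable_integral sub) auto
    then have "y u - y s - (B u - B s) * y s = integral {s..u} (\<lambda>r. b r * y r - b r * y s)"
       and int: "(\<lambda>r. b r * y r - b r * y s) integrable_on {s..u}"
      by (auto simp: integral_unique)
    moreover have "norm (integral {s..u} (\<lambda>r. b r * y r - b r * y s))
        \<le> integral {s..u} (\<lambda>r. M * (\<phi> u - \<phi> s) * norm (b r))"
    proof (intro Henstock_Kurzweil_Integration.integral_norm_bound_integral int)
      show "(\<lambda>r. M * (\<phi> u - \<phi> s) * norm (b r)) integrable_on {s..u}"
        using sub su by (intro integrable_on_mult_right) auto
      fix r assume r: "r \<in> {s..u}"
      have "norm (b r * y r - b r * y s) = norm (b r) * norm (y r - y s)"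
        by (simp add: norm_mult flip: right_diff_distrib)
      also have "\<dots> \<le> norm (b r) * (M * (\<phi> r - \<phi> s))"
        using y_le[of s r] r su by (intro mult_left_mono) auto
      also have "\<dots> \<le> norm (b r) * (M * (\<phi> u - \<phi> s))"
        using \<phi>_mono[of r u] r su M by (intro mult_left_mono) auto
      finally show "norm (b r * y r - b r * y s) \<le> M * (\<phi> u - \<phi> s) * norm (b r)"
        by (simp add: mult_ac)
    qed
    ultimately show ?thesis
      by (simp add: \<phi>_diff[OF su] power2_eq_square mult_ac)
  qed
  define h where "h s = y s * exp (- B s)" for s
  \<comment> \<open>The outer \<open>exp L\<close> bounds \<open>exp (- B u)\<close>. Inside,
    \<open>M\<close> comes from the error of freezing \<open>y\<close>, and \<open>M * exp L\<close>
    from the Taylor remainder of \<open>exp\<close>.\<close>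
  define C where "C = exp L * (M + M * exp L)"
  have "norm (h u - h s) \<le> C * (\<phi> u - \<phi> s)\<^sup>2" if su: "0 \<le> s" "s \<le> u" "u \<le> t" for s u
  proof -
    have su': "0 \<le> s" "s \<le> u" "u \<le> T" using su t by auto
    define \<beta> where "\<beta> = B u - B s"
    define d where "d = \<phi> u - \<phi> s"
    have d: "norm \<beta> \<le> d" "0 \<le> d" "d \<le> L"
      using B_le[OF su'] \<phi>_mono[OF su'] \<phi>_le[of s] \<phi>_le[of u] su' by (auto simp: \<beta>_def d_def)
    have "norm (exp \<beta> - (1 + \<beta>)) \<le> exp (norm \<beta>) * (norm \<beta>)\<^sup>2"
      using Taylor_exp_field[of \<beta> 1] by (simp add: power2_eq_square)
    also have "\<dots> \<le> exp L * d\<^sup>2"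
      using d by (intro mult_mono power_mono) auto
    finally have e1: "norm (exp \<beta> - (1 + \<beta>)) \<le> exp L * d\<^sup>2" .
    have "norm (B u) \<le> L"
      using B_le[of 0 u] \<phi>_le[of u] su' \<phi>0 by auto
    then have e2: "norm (exp (- B u)) \<le> exp L"
      using norm_exp[of "- B u"] by (metis exp_le_cancel_iff norm_minus_cancel order_trans)
    \<comment> \<open>The first-order term \<open>y s * \<beta>\<close> occurs both in the increment
      of \<open>y\<close> and in that of \<open>exp\<close>; it cancels, leaving two quadratic
      errors.\<close>
    have "h u - h s = exp (- B u) * ((y u - y s - y s * \<beta>) - y s * (exp \<beta> - (1 + \<beta>)))"
    proof -
      have "exp (- B s) = exp (- B u) * exp \<beta>"
        by (simp add: \<beta>_def flip: exp_add)
      then show ?thesis by (simp add: h_def algebra_simps)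
    qed
    also have "norm \<dots> \<le> exp L * (M * d\<^sup>2 + M * (exp L * d\<^sup>2))"
      unfolding norm_mult[of "exp (- B u)"]
    proof (rule mult_mono[OF e2 order_trans[OF norm_triangle_ineq4 add_mono]])
      show "norm (y u - y s - y s * \<beta>) \<le> M * d\<^sup>2"
        using y_quad[OF su'] by (simp add: \<beta>_def d_def)
      show "norm (y s * (exp \<beta> - (1 + \<beta>))) \<le> M * (exp L * d\<^sup>2)"
        unfolding norm_mult using M(2)[of s] M(1) su' by (intro mult_mono e1) auto
    qed auto
    finally show ?thesis by (simp add: C_def d_def algebra_simps)
  qed
  then have "h t = h 0"
    using t M c\<phi> \<phi>_mono
    by (intro constant_if_quadratic_variation[of 0 t \<phi> C])
      (auto simp: C_def mono_on_def intro: continuous_on_subset)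
  then show ?thesis
    using \<phi>0 by (simp add: h_def exp_minus field_simps flip: B_def)
qed

text \<open>Since \<open>y\<close> does not vanish, \<open>y' = f\<close> is the linear equation
  with coefficient \<open>f / y\<close>; this is integrable because \<open>1 / y\<close> is
  continuous on a compact interval.\<close>

lemma log_derivative_exp:
  fixes y f :: "real \<Rightarrow> complex"
  assumes T: "0 \<le> T" and f: "f absolutely_integrable_on {0..T}"
    and y: "\<And>t. t \<in> {0..T} \<Longrightarrow> (f has_integral (y t - y 0)) {0..t}"
    and nz: "\<And>t. t \<in> {0..T} \<Longrightarrow> y t \<noteq> 0"
  shows "(\<lambda>t. f t / y t) absolutely_integrable_on {0..T}"
    and "y T = y 0 * exp (integral {0..T} (\<lambda>t. f t / y t))"
proof -
  have "continuous_on {0..T} (\<lambda>t. 1 / y t)"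
    using has_integral_continuous_on[OF T y] nz by (intro continuous_intros) auto
  from continuous_on_mult_absolutely_integrable[OF this f]
  show int: "(\<lambda>t. f t / y t) absolutely_integrable_on {0..T}" by simp
  show "y T = y 0 * exp (integral {0..T} (\<lambda>t. f t / y t))"
  proof (rule linear_ode_exp[where y = y, OF T int])
    fix t assume t: "t \<in> {0..T}"
    show "((\<lambda>s. f s / y s * y s) has_integral y t - y 0) {0..t}"
      using y[OF t] by (rule has_integral_eq[rotated]) (use nz t in auto)
  qed (use T in auto)
qed

subsection \<open>Dependence of the flow on its starting point\<close>

text \<open>Integrability of the speeds is kept for an extension of this locale: for superpositions
  it is itself deduced from the trajectories of the marks, which are studied at this level.\<close>

locale loewner_flow =
  fixes T :: ereal and m :: nat and \<nu> x :: "nat \<Rightarrow> real \<Rightarrow> real"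
    and g :: "real \<Rightarrow> complex \<Rightarrow> complex" and t0 :: real
  assumes chain: "loewner_chain_until T m \<nu> x g"
    and t0: "0 \<le> t0" "ereal t0 < T"
    and x_cont: "\<And>j. j \<in> {1..m} \<Longrightarrow> continuous_on {0..t0} (x j)"
begin

lemma initial [simp]: "g 0 w = w"
  using chain by (simp add: loewner_chain_until_def)

context
  fixes w :: complex and s :: real
  assumes s: "s \<le> t0" "0 \<le> s" and w: "ereal s < swallowing_time m x g w"
begin

lemma not_hit:
  assumes "t \<in> {0..s}" "j \<in> {1..m}"
  shows "g t w \<noteq> complex_of_real (x j t)"
  using ereal_less_first_timeD[of s "hits m x g w" t] w assms
  by (auto simp: swallowing_time_def hits_def)

lemma trajectory:
  assumes t: "t \<in> {0..s}"
  shows "((\<lambda>t. \<Sum>j=1..m. 2 * complex_of_real (\<nu> j t) * (1 / (g t w - complex_of_real (x j t))))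
    has_integral (g t w - g 0 w)) {0..t}"
proof -
  have "ereal t < min (swallowing_time m x g w) T"
    using w t0 s t by (auto intro: le_less_trans[of "ereal t" "ereal s"] le_less_trans[of "ereal t" "ereal t0"])
  then show ?thesis
    using chain t by (auto simp: loewner_chain_until_def solves_until_def)
qed

lemma velocity_integrable:
  "(\<lambda>t. \<Sum>j=1..m. 2 * complex_of_real (\<nu> j t) / (g t w - complex_of_real (x j t)))
    absolutely_integrable_on {0..s}"
proof -
  have "ereal s < min (swallowing_time m x g w) T"
    using w t0 s by (auto intro: le_less_trans[of "ereal s" "ereal t0"])
  then show ?thesis
    using chain s by (auto simp: loewner_chain_until_def solves_until_def)
qed

lemma trajectory_continuous: "continuous_on {0..s} (\<lambda>t. g t w)"
  using s trajectory by (intro has_integral_continuous_on) auto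

lemma inverse_distance_continuous:
  assumes j: "j \<in> {1..m}"
  shows "continuous_on {0..s} (\<lambda>t. 1 / (g t w - complex_of_real (x j t)))"
proof (intro continuous_intros trajectory_continuous)
  show "continuous_on {0..s} (x j)"
    using s by (intro continuous_on_subset[OF x_cont[OF j]]) auto
qed (use not_hit j in auto)

end

end

locale integrable_loewner_flow = loewner_flow +
  assumes \<nu>_int: "\<And>j. j \<in> {1..m} \<Longrightarrow>
      (\<lambda>t. complex_of_real (\<nu> j t)) absolutely_integrable_on {0..t0}"
begin

lemma weighted_sum_integrable:
  assumes "s \<le> t0" and "\<And>j. j \<in> {1..m} \<Longrightarrow> continuous_on {0..s} (c j)"
  shows "(\<lambda>t. \<Sum>j=1..m. 2 * complex_of_real (\<nu> j t) * c j t) absolutely_integrable_on {0..s}"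
proof (intro absolutely_integrable_sum)
  fix j assume j: "j \<in> {1..m}"
  have "(\<lambda>t. complex_of_real (\<nu> j t)) absolutely_integrable_on {0..s}"
    using assms(1) by (intro set_integrable_subset[OF \<nu>_int[OF j]]) auto
  then have "(\<lambda>t. 2 * c j t * complex_of_real (\<nu> j t)) absolutely_integrable_on {0..s}"
    by (intro continuous_on_mult_absolutely_integrable continuous_intros assms j)
  then show "(\<lambda>t. 2 * complex_of_real (\<nu> j t) * c j t) absolutely_integrable_on {0..s}"
    by (simp add: mult_ac)
qed auto

text \<open>A constant independent of the starting point, used as the common majorant in all
  estimates. The absolute values are there because nonnegative speeds are not part of this
  locale.\<close>

definition total_speed :: real where
  "total_speed = integral {0..t0} (\<lambda>t. \<Sum>j=1..m. 2 * \<bar>\<nu> j t\<bar>)"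

lemma total_speed_integrable: "(\<lambda>t. \<Sum>j=1..m. 2 * \<bar>\<nu> j t\<bar>) integrable_on {0..t0}"
proof (intro integrable_sum integrable_on_mult_right)
  fix j assume "j \<in> {1..m}"
  from absolutely_integrable_norm[OF \<nu>_int[OF this]]
  show "(\<lambda>t. \<bar>\<nu> j t\<bar>) integrable_on {0..t0}"
    by (auto simp: absolutely_integrable_on_def comp_def)
qed auto

lemma total_speed_nonneg: "0 \<le> total_speed"
  unfolding total_speed_def
  by (intro integral_nonneg total_speed_integrable) (auto intro!: sum_nonneg)

lemma weighted_sum_bound:
  assumes s: "s \<le> t0" and c: "\<And>j. j \<in> {1..m} \<Longrightarrow> continuous_on {0..s} (c j)"
    and C: "0 \<le> C" "\<And>j t. j \<in> {1..m} \<Longrightarrow> t \<in> {0..s} \<Longrightarrow> norm (c j t) \<le> C"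
  shows "norm (integral {0..s} (\<lambda>t. \<Sum>j=1..m. 2 * complex_of_real (\<nu> j t) * c j t)) \<le> C * total_speed"
proof -
  have int: "(\<lambda>t. \<Sum>j=1..m. 2 * \<bar>\<nu> j t\<bar>) integrable_on {0..s}"
    using s by (intro integrable_subinterval_real[OF total_speed_integrable]) auto
  have "norm (integral {0..s} (\<lambda>t. \<Sum>j=1..m. 2 * complex_of_real (\<nu> j t) * c j t))
      \<le> integral {0..s} (\<lambda>t. C * (\<Sum>j=1..m. 2 * \<bar>\<nu> j t\<bar>))"
  proof (intro Henstock_Kurzweil_Integration.integral_norm_bound_integral integrable_on_mult_right int)
    show "(\<lambda>t. \<Sum>j=1..m. 2 * complex_of_real (\<nu> j t) * c j t) integrable_on {0..s}"
      using weighted_sum_integrable[OF s c] by (simp add: absolutely_integrable_on_def)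
    fix t assume t: "t \<in> {0..s}"
    show "norm (\<Sum>j=1..m. 2 * complex_of_real (\<nu> j t) * c j t) \<le> C * (\<Sum>j=1..m. 2 * \<bar>\<nu> j t\<bar>)"
      unfolding sum_distrib_left
    proof (rule sum_norm_le)
      fix j assume j: "j \<in> {1..m}"
      show "norm (2 * complex_of_real (\<nu> j t) * c j t) \<le> C * (2 * \<bar>\<nu> j t\<bar>)"
        using mult_left_mono[OF C(2)[OF j t], of "2 * \<bar>\<nu> j t\<bar>"]
        by (simp add: norm_mult mult_ac)
    qed
  qed
  also have "\<dots> = C * integral {0..s} (\<lambda>t. \<Sum>j=1..m. 2 * \<bar>\<nu> j t\<bar>)"
    by simp
  also have "\<dots> \<le> C * total_speed"
    unfolding total_speed_def using s
    by (intro mult_left_mono integral_subset_le int total_speed_integrable C) (auto intro!: sum_nonneg)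
  finally show ?thesis .
qed

text \<open>With \<open>p\<close> and \<open>q\<close> the distances of the two trajectories to a
  driving point, \<open>1 / p - 1 / q = - (p - q) / (p * q)\<close>, and \<open>p - q\<close> is the
  same for every driving point. Hence the difference solves a scalar linear equation. The case
  \<open>w = z\<close> of the first claim gives the integrability of the exponent of the derivative;
  a mark in place of \<open>z\<close> gives the factors in the denominator of the motion
  integral.\<close>

lemma difference_formula:
  assumes s: "0 \<le> s" "s \<le> t0"
    and w: "ereal s < swallowing_time m x g w" and z: "ereal s < swallowing_time m x g z"
  defines "K \<equiv> (\<lambda>t. \<Sum>j=1..m. 2 * complex_of_real (\<nu> j t) *
    (1 / (g t w - complex_of_real (x j t)) * (1 / (g t z - complex_of_real (x j t)))))"
  shows "K absolutely_integrable_on {0..s}"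
    and "g s w - g s z = (w - z) * exp (- integral {0..s} K)"
proof -
  show K: "K absolutely_integrable_on {0..s}"
    unfolding K_def
    by (intro weighted_sum_integrable s continuous_on_mult inverse_distance_continuous w z)
  have "g s w - g s z = (g 0 w - g 0 z) * exp (integral {0..s} (\<lambda>t. - K t))"
  proof (rule linear_ode_exp[where y = "\<lambda>t. g t w - g t z", OF s(1)])
    show "(\<lambda>t. - K t) absolutely_integrable_on {0..s}"
      using K by (simp add: absolutely_integrable_on_def integrable_neg)
    fix t assume t: "t \<in> {0..s}"
    have "((\<lambda>t. (\<Sum>j=1..m. 2 * complex_of_real (\<nu> j t) * (1 / (g t w - complex_of_real (x j t)))) -
        (\<Sum>j=1..m. 2 * complex_of_real (\<nu> j t) * (1 / (g t z - complex_of_real (x j t)))))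
      has_integral ((g t w - g 0 w) - (g t z - g 0 z))) {0..t}"
      by (intro has_integral_diff trajectory[OF s(2,1) w t] trajectory[OF s(2,1) z t])
    then have "((\<lambda>t. - K t * (g t w - g t z)) has_integral ((g t w - g 0 w) - (g t z - g 0 z))) {0..t}"
    proof (rule has_integral_eq[rotated])
      fix u assume u: "u \<in> {0..t}"
      have "a * (1 / p) - a * (1 / q) = - (a * (1 / p * (1 / q)) * (p - q))"
        if "p \<noteq> 0" "q \<noteq> 0" for a p q :: complex
        using that by (simp add: field_simps)
      note eq = this
      have "(\<Sum>j=1..m. 2 * complex_of_real (\<nu> j u) * (1 / (g u w - complex_of_real (x j u)))) -
          (\<Sum>j=1..m. 2 * complex_of_real (\<nu> j u) * (1 / (g u z - complex_of_real (x j u)))) =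
        (\<Sum>j=1..m. - (2 * complex_of_real (\<nu> j u) * (1 / (g u w - complex_of_real (x j u)) * 
          (1 / (g u z - complex_of_real (x j u)))) * 
          ((g u w - complex_of_real (x j u)) - (g u z - complex_of_real (x j u)))))"
        unfolding sum_subtractf[symmetric]
        using u t not_hit[OF s(2,1) w] not_hit[OF s(2,1) z]
        by (intro sum.cong refl eq) auto
      also have "\<dots> = - K u * (g u w - g u z)"
        unfolding K_def by (simp add: sum_distrib_right sum_negf)
      finally show "(\<Sum>j=1..m. 2 * complex_of_real (\<nu> j u) * (1 / (g u w - complex_of_real (x j u)))) -
          (\<Sum>j=1..m. 2 * complex_of_real (\<nu> j u) * (1 / (g u z - complex_of_real (x j u)))) =
        - K u * (g u w - g u z)" .
    qed
    then show "((\<lambda>t. - K t * (g t w - g t z)) has_integral ((g t w - g t z) - (g 0 w - g 0 z))) {0..t}"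
      by (simp add: algebra_simps)
  qed (use s in auto)
  then show "g s w - g s z = (w - z) * exp (- integral {0..s} K)"
    by simp
qed

section \<open>Stability of trajectories under a small change of the starting point\<close>

lemma distance_to_driving_points:
  assumes z: "ereal t0 < swallowing_time m x g z"
  obtains \<delta> where "0 < \<delta>"
    "\<And>j t. j \<in> {1..m} \<Longrightarrow> t \<in> {0..t0} \<Longrightarrow> \<delta> \<le> norm (g t z - complex_of_real (x j t))"
proof -
  have "continuous_on {0..t0} (\<lambda>t. \<Sum>j=1..m. norm (1 / (g t z - complex_of_real (x j t))))"
    by (intro continuous_on_sum continuous_on_norm inverse_distance_continuous z) (use t0 in auto)
  from continuous_on_compact_bound[OF compact_Icc this] obtain B where B: "0 \<le> B"
    "\<And>t. t \<in> {0..t0} \<Longrightarrow> norm (\<Sum>j=1..m. norm (1 / (g t z - complex_of_real (x j t)))) \<le> B" by metis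
  show ?thesis
  \<comment> \<open>A bound \<open>B\<close> on the sum of the reciprocal distances bounds all
    distances from below at once; \<open>B\<close> may be 0, hence the added 1.\<close>
  proof (rule that[of "1 / (B + 1)"])
    show "0 < 1 / (B + 1)" using B by auto
    fix j t assume j: "j \<in> {1..m}" and t: "t \<in> {0..t0}"
    have "g t z - complex_of_real (x j t) \<noteq> 0"
      using not_hit[OF order_refl t0(1) z t j] by simp
    moreover have "norm (1 / (g t z - complex_of_real (x j t))) \<le> B"
      using B(2)[OF t] member_le_sum[OF j, of "\<lambda>j. norm (1 / (g t z - complex_of_real (x j t)))"] by auto
    ultimately show "1 / (B + 1) \<le> norm (g t z - complex_of_real (x j t))"
      using B(1) by (simp add: norm_divide field_simps add_increasing)
  qed
qed

text \<open>The factor \<open>2 / \<delta>\<^sup>2\<close> is the product of the reciprocals of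
  \<open>\<delta> / 2\<close> and \<open>\<delta>\<close>. Separation is required only up to time
  \<open>s\<close>, so that the estimate can be applied at a first exit time.\<close>

lemma difference_bound:
  assumes s: "0 \<le> s" "s \<le> t0"
    and w: "ereal s < swallowing_time m x g w" and z: "ereal s < swallowing_time m x g z"
    and \<delta>: "0 < \<delta>"
      "\<And>j t. j \<in> {1..m} \<Longrightarrow> t \<in> {0..s} \<Longrightarrow> \<delta> \<le> norm (g t z - complex_of_real (x j t))"
      "\<And>j t. j \<in> {1..m} \<Longrightarrow> t \<in> {0..s} \<Longrightarrow> \<delta> / 2 \<le> norm (g t w - complex_of_real (x j t))"
  shows "norm (g s w - g s z) \<le> norm (w - z) * exp (2 / \<delta>\<^sup>2 * total_speed)"
proof -
  define I where "I = integral {0..s} (\<lambda>t. \<Sum>j=1..m. 2 * complex_of_real (\<nu> j t) *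
    (1 / (g t w - complex_of_real (x j t)) * (1 / (g t z - complex_of_real (x j t)))))"
  have "norm I \<le> 2 / \<delta>\<^sup>2 * total_speed"
    unfolding I_def
  proof (intro weighted_sum_bound s continuous_on_mult inverse_distance_continuous w z)
    fix j t assume jt: "j \<in> {1..m}" "t \<in> {0..s}"
    have "1 / norm (g t w - complex_of_real (x j t)) * (1 / norm (g t z - complex_of_real (x j t)))
        \<le> 1 / (\<delta> / 2) * (1 / \<delta>)"
      using \<delta>(1) \<delta>(2,3)[OF jt] by (intro mult_mono frac_le) auto
    then show "norm (1 / (g t w - complex_of_real (x j t)) * (1 / (g t z - complex_of_real (x j t)))) \<le> 2 / \<delta>\<^sup>2"
      by (simp add: norm_mult norm_divide power2_eq_square)
  qed (use \<delta> in auto)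
  then have "norm (exp (- I)) \<le> exp (2 / \<delta>\<^sup>2 * total_speed)"
    using norm_exp[of "- I"] by (metis exp_le_cancel_iff norm_minus_cancel order_trans)
  then show ?thesis
    unfolding difference_formula(2)[OF s w z] norm_mult I_def
    by (intro mult_left_mono) auto
qed

text \<open>
  As long as the trajectories of \<open>w\<close> and \<open>z\<close> stay within \<open>\<delta> / 2\<close> of each other, the difference
  formula keeps them there, so \<open>w\<close> cannot be swallowed first.
\<close>

lemma nearby_trajectories:
  assumes z: "ereal t0 < swallowing_time m x g z"
    and \<delta>: "0 < \<delta>"
      "\<And>j t. j \<in> {1..m} \<Longrightarrow> t \<in> {0..t0} \<Longrightarrow> \<delta> \<le> norm (g t z - complex_of_real (x j t))"
    and near: "norm (w - z) * exp (2 / \<delta>\<^sup>2 * total_speed) < \<delta> / 2"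
  shows "ereal t0 < swallowing_time m x g w"
    and "\<And>t. t \<in> {0..t0} \<Longrightarrow> norm (g t w - g t z) < \<delta> / 2"
proof -
  have z': "ereal s < swallowing_time m x g z" if "s \<le> t0" for s
    using z that by (meson ereal_less_eq(3) le_less_trans)
  have "norm (w - z) * 1 \<le> norm (w - z) * exp (2 / \<delta>\<^sup>2 * total_speed)"
    using total_speed_nonneg by (intro mult_left_mono) auto
  then have near0: "norm (w - z) < \<delta> / 2"
    using near by simp
  have w_far: "\<delta> / 2 \<le> norm (g t w - complex_of_real (x j t))"
    if "j \<in> {1..m}" "t \<in> {0..t0}" "norm (g t w - g t z) \<le> \<delta> / 2" for j t
  proof -
    have "norm (g t z - complex_of_real (x j t)) \<le>
        norm (g t w - complex_of_real (x j t)) + norm (g t w - g t z)"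
      using norm_triangle_ineq4[of "g t w - complex_of_real (x j t)" "g t w - g t z"] by simp
    then show ?thesis using \<delta>(2)[OF that(1,2)] that(3) by simp
  qed
  have close: "norm (g s w - g s z) < \<delta> / 2"
    if s: "0 \<le> s" "s \<le> t0" and w: "ereal s < swallowing_time m x g w" for s
  proof (rule ccontr)
    assume far: "\<not> norm (g s w - g s z) < \<delta> / 2"
    have cont: "continuous_on {0..s} (\<lambda>t. norm (g t w - g t z))"
      by (intro continuous_intros trajectory_continuous s w z')
    \<comment> \<open>\<open>S\<close> consists of the times at which the two trajectories are at
      least \<open>\<delta> / 2\<close> apart. It is compact and nonempty, so there is a first such
      time \<open>s1\<close>, where the distance is exactly \<open>\<delta> / 2\<close>.\<close>
    define S where "S = {0..s} \<inter> (\<lambda>t. norm (g t w - g t z)) -` {\<delta> / 2..}"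
    have "closed S"
      unfolding S_def by (rule continuous_closed_preimage[OF cont]) auto
    moreover have "S \<subseteq> {0..s}" "s \<in> S"
      using far s by (auto simp: S_def)
    ultimately obtain s1 where s1: "s1 \<in> S" "\<And>t. t \<in> S \<Longrightarrow> s1 \<le> t"
      using compact_attains_inf[of S] compact_Icc[of 0 s]
      by (metis compact_Int_closed empty_iff inf.absorb_iff2)
    then have s1s: "0 \<le> s1" "s1 \<le> s" "\<delta> / 2 \<le> norm (g s1 w - g s1 z)"
      by (auto simp: S_def)
    have "continuous_on {0..s1} (\<lambda>t. norm (g t w - g t z))"
      using s1s by (intro continuous_on_subset[OF cont]) auto
    then obtain t where t: "0 \<le> t" "t \<le> s1" "norm (g t w - g t z) = \<delta> / 2"
      using IVT'[of "\<lambda>t. norm (g t w - g t z)" 0 "\<delta> / 2" s1] s1s near0 by auto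
    then have "t = s1"
      using s1(2)[of t] s1s by (auto simp: S_def)
    with t have at_s1: "norm (g s1 w - g s1 z) = \<delta> / 2" by simp
    have before: "norm (g t w - g t z) \<le> \<delta> / 2" if "t \<in> {0..s1}" for t
      using s1(2)[of t] that s1s at_s1 by (cases "t = s1"; cases "norm (g t w - g t z) \<le> \<delta> / 2") (auto simp: S_def)
    \<comment> \<open>Up to \<open>s1\<close> the trajectory of \<open>w\<close> keeps distance
      \<open>\<delta> / 2\<close> from the driving points, so the estimate applies, and
      \<open>near\<close> makes its right-hand side strictly smaller than
      \<open>\<delta> / 2\<close>.\<close>
    have "norm (g s1 w - g s1 z) \<le> norm (w - z) * exp (2 / \<delta>\<^sup>2 * total_speed)"
      using s s1s \<delta> before w
      by (intro difference_bound w_far z') (auto intro: le_less_trans[of "ereal s1" "ereal s"])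
    then show False
      using near s1s by simp
  qed
  show w: "ereal t0 < swallowing_time m x g w"
  proof (rule ccontr)
    assume "\<not> ereal t0 < swallowing_time m x g w"
    moreover have "0 \<le> swallowing_time m x g w"
      by (simp add: swallowing_time_def first_time_nonneg)
    ultimately obtain t1 where t1: "swallowing_time m x g w = ereal t1" "0 \<le> t1" "t1 \<le> t0"
      by (cases "swallowing_time m x g w") auto
    then have "ereal t1 < T"
      using t0 by (meson ereal_less_eq(3) le_less_trans)
    \<comment> \<open>This is where the last clause of \<open>loewner_chain_until\<close> enters: at
      its swallowing time the trajectory really meets a driving point and is the limit of its
      past.\<close>
    then have hit: "hits m x g w t1" and cont: "continuous (at t1 within {0..t1}) (\<lambda>s. g s w)"
      using chain t1 by (auto simp: loewner_chain_until_def)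
    have "norm (g t1 w - g t1 z) \<le> \<delta> / 2"
    \<comment> \<open>For \<open>t1 = 0\<close> there is no past to take a limit from, and the
      initial distance is used. Otherwise the strict bound before \<open>t1\<close> passes to a weak
      one at \<open>t1\<close>, which still contradicts a hit, since \<open>z\<close> stays at
      distance \<open>\<delta>\<close> from the driving points.\<close>
    proof (cases "t1 = 0")
      case True
      then show ?thesis using near0 by simp
    next
      case False
      have "continuous_on {0..t1} (\<lambda>s. g s z)"
        using t1 by (intro trajectory_continuous z')
      then have "continuous (at t1 within {0..t1}) (\<lambda>s. g s z)"
        using t1 by (simp add: continuous_on_eq_continuous_within)
      then have "((\<lambda>s. norm (g s w - g s z)) \<longlongrightarrow> norm (g t1 w - g t1 z)) (at t1 within {0..t1})"
        using cont by (intro tendsto_intros) (simp_all add: continuous_within)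
      moreover have "eventually (\<lambda>s. norm (g s w - g s z) \<le> \<delta> / 2) (at t1 within {0..t1})"
        unfolding eventually_at_filter
        by (rule always_eventually) (use close t1 in \<open>auto simp: less_imp_le\<close>)
      moreover have "at t1 within {0..t1} \<noteq> bot"
        using False t1 by (simp add: at_within_Icc_at_left)
      ultimately show ?thesis
        by (metis tendsto_upperbound)
    qed
    moreover obtain j where "j \<in> {1..m}" "g t1 w = complex_of_real (x j t1)"
      using hit by (auto simp: hits_def)
    ultimately show False
      using \<delta>(2)[of j t1] \<delta>(1) t1 by (simp add: norm_minus_commute)
  qed
  show "norm (g t w - g t z) < \<delta> / 2" if "t \<in> {0..t0}" for t
    using that w by (intro close) (auto intro: le_less_trans[of "ereal t" "ereal t0"])
qed

text \<open>By the difference formula the difference quotient is exactly \<open>exp (- I w)\<close>,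
  so differentiability reduces to continuity of \<open>I\<close> at \<open>z\<close>. This follows
  from a Lipschitz estimate at \<open>z\<close>, with no interchange of limit and integral.\<close>

lemma spatial_derivative:
  assumes z: "ereal t0 < swallowing_time m x g z"
  defines "A \<equiv> (\<lambda>t. \<Sum>j=1..m. 2 * complex_of_real (\<nu> j t) *
    (1 / (g t z - complex_of_real (x j t)) * (1 / (g t z - complex_of_real (x j t)))))"
  shows "(g t0 has_field_derivative exp (- integral {0..t0} A)) (at z)"
proof -
  obtain \<delta> where \<delta>: "0 < \<delta>"
    "\<And>j t. j \<in> {1..m} \<Longrightarrow> t \<in> {0..t0} \<Longrightarrow> \<delta> \<le> norm (g t z - complex_of_real (x j t))"
    using distance_to_driving_points[OF z] by metis
  define E where "E = exp (2 / \<delta>\<^sup>2 * total_speed)"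
  define I where "I w = integral {0..t0} (\<lambda>t. \<Sum>j=1..m. 2 * complex_of_real (\<nu> j t) *
    (1 / (g t w - complex_of_real (x j t)) * (1 / (g t z - complex_of_real (x j t)))))" for w
  have E: "0 < E" by (simp add: E_def)
  \<comment> \<open>Chosen so that \<open>dist w z < \<epsilon>\<close> is precisely the smallness
    condition for trajectories to stay within \<open>\<delta> / 2\<close> of each other.\<close>
  define \<epsilon> where "\<epsilon> = \<delta> / 2 / E"
  have \<epsilon>: "0 < \<epsilon>" using \<delta> E by (simp add: \<epsilon>_def)
  have key: "ereal t0 < swallowing_time m x g w \<and> norm (I w - I z) \<le> norm (w - z) * E * (2 / \<delta> ^ 3) * total_speed"
    if "dist w z < \<epsilon>" for w
  proof -
    have near: "norm (w - z) * E < \<delta> / 2"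
      using that E by (simp add: \<epsilon>_def dist_norm field_simps)
    have w: "ereal t0 < swallowing_time m x g w"
      by (rule nearby_trajectories(1)[OF z \<delta>(1) _ near[unfolded E_def]]) (rule \<delta>(2))
    have nb: "norm (g t w - g t z) < \<delta> / 2" if "t \<in> {0..t0}" for t
      by (rule nearby_trajectories(2)[OF z \<delta>(1) _ near[unfolded E_def] that]) (rule \<delta>(2))
    have w_far: "\<delta> / 2 \<le> norm (g t w - complex_of_real (x j t))"
      if "j \<in> {1..m}" "t \<in> {0..t0}" for j t
    proof -
      have "norm (g t z - complex_of_real (x j t)) \<le>
          norm (g t w - complex_of_real (x j t)) + norm (g t w - g t z)"
        using norm_triangle_ineq4[of "g t w - complex_of_real (x j t)" "g t w - g t z"] by simp
      then show ?thesis using \<delta>(2)[OF that] nb[OF that(2)] by simp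
    qed
    have D: "norm (g t w - g t z) \<le> norm (w - z) * E" if "t \<in> {0..t0}" for t
      unfolding E_def using that w z \<delta> w_far
      by (intro difference_bound) (auto intro: le_less_trans[of "ereal t" "ereal t0"])
    define c where "c u j t = 1 / (g t u - complex_of_real (x j t)) * (1 / (g t z - complex_of_real (x j t)))"
      for u j t
    have cc: "continuous_on {0..t0} (c u j)" if "ereal t0 < swallowing_time m x g u" "j \<in> {1..m}" for u j
      unfolding c_def using that z t0 by (intro continuous_on_mult inverse_distance_continuous) auto
    have "I w - I z = integral {0..t0} (\<lambda>t. (\<Sum>j=1..m. 2 * complex_of_real (\<nu> j t) * c w j t) -
        (\<Sum>j=1..m. 2 * complex_of_real (\<nu> j t) * c z j t))"
      unfolding I_def c_def[symmetric]
      using weighted_sum_integrable[OF order_refl cc] w z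
      by (intro integral_diff[symmetric]) (auto simp: absolutely_integrable_on_def)
    also have "\<dots> = integral {0..t0} (\<lambda>t. \<Sum>j=1..m. 2 * complex_of_real (\<nu> j t) * (c w j t - c z j t))"
      by (simp add: sum_subtractf right_diff_distrib)
    also have "norm \<dots> \<le> (norm (w - z) * E * (2 / \<delta> ^ 3)) * total_speed"
    proof (intro weighted_sum_bound continuous_on_diff cc w z)
      fix j t assume jt: "j \<in> {1..m}" "t \<in> {0..t0}"
      define p where "p = g t w - complex_of_real (x j t)"
      define q where "q = g t z - complex_of_real (x j t)"
      have pq: "\<delta> / 2 \<le> norm p" "\<delta> \<le> norm q"
        using w_far \<delta>(2) jt by (auto simp: p_def q_def)
      then have "p \<noteq> 0" "q \<noteq> 0" using \<delta>(1) by auto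
      \<comment> \<open>The difference is \<open>1 / (p * q) - 1 / (q * q)\<close>. With
        \<open>norm p\<close> at least \<open>\<delta> / 2\<close> and \<open>norm q\<close> at
        least \<open>\<delta>\<close>, this is the source of the constant
        \<open>2 / \<delta> ^ 3\<close>.\<close>
      then have "c w j t - c z j t = - ((p - q) * (1 / (p * (q * q))))"
        by (simp add: c_def flip: p_def q_def) (simp add: field_simps)
      also have "norm \<dots> = norm (g t w - g t z) * (1 / (norm p * (norm q * norm q)))"
        by (simp add: norm_mult norm_divide p_def q_def)
      also have "\<dots> \<le> norm (w - z) * E * (1 / (\<delta> / 2 * (\<delta> * \<delta>)))"
        using D[OF jt(2)] pq \<delta>(1) E by (intro mult_mono frac_le) auto
      also have "\<dots> = norm (w - z) * E * (2 / \<delta> ^ 3)"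
        by (simp add: power3_eq_cube)
      finally show "norm (c w j t - c z j t) \<le> norm (w - z) * E * (2 / \<delta> ^ 3)" .
    qed (use E \<delta> in auto)
    finally show ?thesis using w by simp
  qed
  have "((\<lambda>w. norm (w - z) * E * (2 / \<delta> ^ 3) * total_speed) \<longlongrightarrow> norm (z - z) * E * (2 / \<delta> ^ 3) * total_speed) (at z)"
    by (intro tendsto_intros)
  then have lim0: "((\<lambda>w. norm (w - z) * E * (2 / \<delta> ^ 3) * total_speed) \<longlongrightarrow> 0) (at z)"
    by simp
  have ev: "eventually (\<lambda>w. dist w z < \<epsilon> \<and> w \<noteq> z) (at z)"
    using \<epsilon> by (auto simp: eventually_at intro: exI[of _ \<epsilon>])
  have "((\<lambda>w. I w - I z) \<longlongrightarrow> 0) (at z)"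
    by (rule Lim_null_comparison[OF _ lim0]) (use ev key in \<open>auto elim: eventually_mono\<close>)
  then have "(I \<longlongrightarrow> I z) (at z)"
    by (simp add: LIM_zero_cancel)
  then have "((\<lambda>w. exp (- I w)) \<longlongrightarrow> exp (- I z)) (at z)"
    by (intro tendsto_intros)
  then have "((\<lambda>w. (g t0 w - g t0 z) / (w - z)) \<longlongrightarrow> exp (- I z)) (at z)"
  proof (rule Lim_transform_eventually)
    show "\<forall>\<^sub>F w in at z. exp (- I w) = (g t0 w - g t0 z) / (w - z)"
      using ev
    proof eventually_elim
      case (elim w)
      with key[of w] show ?case
        using difference_formula(2)[OF t0(1) order_refl _ z, of w] by (simp add: I_def)
    qed
  qed
  then show ?thesis
    by (simp add: has_field_derivative_iff I_def A_def)
qed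

end

subsection \<open>Algebraic identities\<close>

text \<open>
  The right-hand side of the driving equation for driving points \<open>a\<close>, finite marked points \<open>c\<close> and
  speeds \<open>p\<close>; a marked point at infinity contributes nothing.
\<close>

definition drift ::
  "'a set \<Rightarrow> 'b set \<Rightarrow> ('a \<Rightarrow> complex) \<Rightarrow> ('b \<Rightarrow> complex) \<Rightarrow> ('a \<Rightarrow> complex) \<Rightarrow> 'a \<Rightarrow> complex" where
  "drift J F a c p j =
     p j * ((\<Sum>k\<in>J - {j}. 2 / (a j - a k)) - (\<Sum>k\<in>F. 4 / (a j - c k))) +
     (\<Sum>k\<in>J - {j}. 2 * p k / (a j - a k))"

lemma sum_off_diagonal_swap:
  fixes f :: "'a \<Rightarrow> 'a \<Rightarrow> complex"
  assumes "finite J"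
  shows "(\<Sum>j\<in>J. \<Sum>k\<in>J - {j}. f j k) = (\<Sum>j\<in>J. \<Sum>k\<in>J - {j}. f k j)"
proof -
  have "J - {j} = {k \<in> J. k \<noteq> j}" "J - {j} = {k \<in> J. j \<noteq> k}" for j by auto
  then show ?thesis
    using sum.swap_restrict[OF assms assms, of f "\<lambda>j k. k \<noteq> j"] by simp
qed

text \<open>Exchanging the two indices in the terms carrying \<open>p k\<close> lets every term
  carry \<open>p j\<close>. What multiplies \<open>2 * p j\<close> is then the divided difference of
  \<open>h\<close> at \<open>a j\<close> and \<open>a k\<close>. It is explicit in both
  applications: it equals 1 for \<open>h = a\<close>, and \<open>h j * h k\<close> for
  \<open>h j = 1 / (G - a j)\<close>.\<close>

lemma weighted_sum_drift:
  assumes J: "finite J"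
  shows "(\<Sum>j\<in>J. h j * drift J F a c p j) =
    (\<Sum>j\<in>J. \<Sum>k\<in>J - {j}. 2 * p j * (h j / (a j - a k) + h k / (a k - a j))) -
    (\<Sum>k\<in>F. \<Sum>j\<in>J. 4 * p j * h j / (a j - c k))"
proof -
  have "(\<Sum>j\<in>J. h j * drift J F a c p j) =
      (\<Sum>j\<in>J. \<Sum>k\<in>J - {j}. 2 * p j * h j / (a j - a k)) -
      (\<Sum>j\<in>J. \<Sum>k\<in>F. 4 * p j * h j / (a j - c k)) +
      (\<Sum>j\<in>J. \<Sum>k\<in>J - {j}. 2 * p k * h j / (a j - a k))"
    unfolding sum_subtractf[symmetric] sum.distrib[symmetric] drift_def
    by (intro sum.cong refl) (simp add: algebra_simps sum_distrib_left)
  also have "(\<Sum>j\<in>J. \<Sum>k\<in>J - {j}. 2 * p k * h j / (a j - a k)) =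
      (\<Sum>j\<in>J. \<Sum>k\<in>J - {j}. 2 * p j * h k / (a k - a j))"
    by (rule sum_off_diagonal_swap[OF J])
  also have "(\<Sum>j\<in>J. \<Sum>k\<in>F. 4 * p j * h j / (a j - c k)) = (\<Sum>k\<in>F. \<Sum>j\<in>J. 4 * p j * h j / (a j - c k))"
    by (rule sum.swap)
  finally show ?thesis
    by (simp add: sum.distrib algebra_simps)
qed

text \<open>
  This is the time derivative of half of \<open>(\<Sum>j\<in>J. (a j)\<^sup>2) - 2 * (\<Sum>k\<in>F. (c k)\<^sup>2)\<close>.
\<close>

lemma drift_second_moment:
  assumes J: "finite J" and a: "inj_on a J" and c: "\<And>j k. j \<in> J \<Longrightarrow> k \<in> F \<Longrightarrow> c k \<noteq> a j"
  shows "(\<Sum>j\<in>J. a j * drift J F a c p j) - 2 * (\<Sum>k\<in>F. c k * (\<Sum>j\<in>J. 2 * p j / (c k - a j))) =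
    (2 * (of_nat (card J) - 1) - 4 * of_nat (card F)) * (\<Sum>j\<in>J. p j)"
proof -
  have "(\<Sum>j\<in>J. \<Sum>k\<in>J - {j}. 2 * p j * (a j / (a j - a k) + a k / (a k - a j))) =
      (\<Sum>j\<in>J. \<Sum>k\<in>J - {j}. 2 * p j)"
  proof (intro sum.cong refl)
    fix j k assume "j \<in> J" "k \<in> J - {j}"
    then have "a j \<noteq> a k" using a by (auto simp: inj_on_def)
    then have "a j / (a j - a k) + a k / (a k - a j) = 1"
      by (simp add: divide_simps)  (simp add: algebra_simps)
    then show "2 * p j * (a j / (a j - a k) + a k / (a k - a j)) = 2 * p j" by simp
  qed
  also have "\<dots> = (\<Sum>j\<in>J. (of_nat (card J) - 1) * (2 * p j))"
  proof (intro sum.cong refl)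
    fix j assume j: "j \<in> J"
    then have "1 \<le> card J" using J by (auto simp: Suc_le_eq card_gt_0_iff)
    then show "(\<Sum>k\<in>J - {j}. 2 * p j) = (of_nat (card J) - 1) * (2 * p j)"
      using j J by (simp add: of_nat_diff)
  qed
  also have "\<dots> = 2 * (of_nat (card J) - 1) * (\<Sum>j\<in>J. p j)"
    unfolding sum_distrib_left[symmetric] by (simp only: mult_ac)
  finally have 1: "(\<Sum>j\<in>J. \<Sum>k\<in>J - {j}. 2 * p j * (a j / (a j - a k) + a k / (a k - a j))) =
      2 * (of_nat (card J) - 1) * (\<Sum>j\<in>J. p j)" .
  \<comment> \<open>The weight 2 on the second moment of the marks is what makes the two numerators
    combine to \<open>4 * p j * (a j - c k)\<close>, cancelling the denominator.\<close>
  have "(\<Sum>k\<in>F. \<Sum>j\<in>J. 4 * p j * a j / (a j - c k)) + 2 * (\<Sum>k\<in>F. c k * (\<Sum>j\<in>J. 2 * p j / (c k - a j))) =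
      (\<Sum>k\<in>F. \<Sum>j\<in>J. 4 * p j)"
    unfolding sum_distrib_left sum.distrib[symmetric]
  proof (intro sum.cong refl)
    fix j k assume "j \<in> J" "k \<in> F"
    then have "c k \<noteq> a j" using c by auto
    then show "4 * p j * a j / (a j - c k) + 2 * (c k * (2 * p j / (c k - a j))) = 4 * p j"
      by (simp add: divide_simps) (simp add: algebra_simps)
  qed
  also have "\<dots> = 4 * of_nat (card F) * (\<Sum>j\<in>J. p j)"
    unfolding sum_distrib_left[symmetric] by simp
  finally show ?thesis
    using 1 unfolding weighted_sum_drift[OF J] by (simp add: algebra_simps)
qed

text \<open>The three summands are the logarithmic time derivatives of \<open>g'\<close>, of the
  product over driving points, and of the product over marks to the power -2. With
  \<open>r j = 1 / (G - a j)\<close>, the diagonal part of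
  \<open>(\<Sum>j\<in>J. r j) * (\<Sum>i\<in>J. 2 * p i * r i)\<close> cancels the first summand,
  its off-diagonal part cancels the interaction of the driving points in the drift, and the mark
  terms of the drift cancel the third summand.\<close>

lemma log_derivative_cancels:
  assumes J: "finite J" and a: "inj_on a J" and c: "\<And>j k. j \<in> J \<Longrightarrow> k \<in> F \<Longrightarrow> c k \<noteq> a j"
    and G: "\<And>j. j \<in> J \<Longrightarrow> G \<noteq> a j"
  shows "- (\<Sum>j\<in>J. 2 * p j * (1 / (G - a j) * (1 / (G - a j)))) +
    (\<Sum>j\<in>J. ((\<Sum>i\<in>J. 2 * p i * (1 / (G - a i))) - drift J F a c p j) / (G - a j)) +
    2 * (\<Sum>k\<in>F. \<Sum>j\<in>J. 2 * p j * (1 / (G - a j) * (1 / (c k - a j)))) = 0"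
proof -
  define r where "r j = 1 / (G - a j)" for j
  have "(\<Sum>j\<in>J. r j * drift J F a c p j) =
      (\<Sum>j\<in>J. \<Sum>k\<in>J - {j}. 2 * p j * (r j * r k)) + 2 * (\<Sum>k\<in>F. \<Sum>j\<in>J. 2 * p j * (r j * (1 / (c k - a j))))"
  proof -
    have "(\<Sum>j\<in>J. \<Sum>k\<in>J - {j}. 2 * p j * (r j / (a j - a k) + r k / (a k - a j))) =
        (\<Sum>j\<in>J. \<Sum>k\<in>J - {j}. 2 * p j * (r j * r k))"
    proof (intro sum.cong refl)
      fix j k assume jk: "j \<in> J" "k \<in> J - {j}"
      then have "a j - a k \<noteq> 0" "G - a j \<noteq> 0" "G - a k \<noteq> 0"
        using a G by (auto simp: inj_on_def)
      moreover have "r j / (a j - a k) + r k / (a k - a j) = (r j - r k) / (a j - a k)"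
        by (metis diff_divide_distrib minus_diff_eq minus_divide_right uminus_add_conv_diff add.commute)
      ultimately have "r j / (a j - a k) + r k / (a k - a j) = r j * r k"
        unfolding r_def by (simp add: divide_simps)
      then show "2 * p j * (r j / (a j - a k) + r k / (a k - a j)) = 2 * p j * (r j * r k)" by simp
    qed
    moreover have "(\<Sum>k\<in>F. \<Sum>j\<in>J. 4 * p j * r j / (a j - c k)) =
        - (2 * (\<Sum>k\<in>F. \<Sum>j\<in>J. 2 * p j * (r j * (1 / (c k - a j)))))"
      unfolding sum_distrib_left sum_negf[symmetric]
      by (intro sum.cong refl) (simp add: minus_divide_right)
    ultimately show ?thesis
      unfolding weighted_sum_drift[OF J] by simp
  qed
  moreover have "(\<Sum>j\<in>J. r j * (\<Sum>i\<in>J. 2 * p i * r i)) =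
      (\<Sum>j\<in>J. 2 * p j * (r j * r j)) + (\<Sum>j\<in>J. \<Sum>k\<in>J - {j}. 2 * p j * (r j * r k))"
  proof -
    have "(\<Sum>j\<in>J. r j * (\<Sum>i\<in>J. 2 * p i * r i)) = (\<Sum>j\<in>J. \<Sum>k\<in>J. 2 * p j * (r j * r k))"
      unfolding sum_distrib_left by (subst sum.swap) (simp add: mult_ac)
    also have "\<dots> = (\<Sum>j\<in>J. 2 * p j * (r j * r j) + (\<Sum>k\<in>J - {j}. 2 * p j * (r j * r k)))"
      using J by (intro sum.cong refl sum.remove)
    finally show ?thesis by (simp add: sum.distrib)
  qed
  moreover have "(\<Sum>j\<in>J. ((\<Sum>i\<in>J. 2 * p i * r i) - drift J F a c p j) / (G - a j)) =
      (\<Sum>j\<in>J. r j * (\<Sum>i\<in>J. 2 * p i * r i)) - (\<Sum>j\<in>J. r j * drift J F a c p j)"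
    unfolding sum_subtractf[symmetric]
    by (intro sum.cong refl) (simp add: r_def diff_divide_distrib)
  ultimately show ?thesis
    unfolding r_def[symmetric] by simp
qed

subsection \<open>Superpositions\<close>

definition finite_marks :: "nat \<Rightarrow> (nat \<Rightarrow> complex option) \<Rightarrow> nat set" where
  "finite_marks n \<zeta> = {k\<in>{1..n+1}. \<zeta> k \<noteq> None}"

lemma finite_finite_marks [simp]: "finite (finite_marks n \<zeta>)"
  by (simp add: finite_marks_def)

text \<open>Injectivity allows the value \<open>None\<close> at most once. The count decides that
  the factor in the second-moment identity is nonzero.\<close>

lemma card_finite_marks:
  assumes "inj_on \<zeta> {1..n+1}"
  shows "card (finite_marks n \<zeta>) = n \<or> card (finite_marks n \<zeta>) = n + 1"
proof (cases "\<exists>k\<in>{1..n+1}. \<zeta> k = None")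
  case True
  then obtain k where k: "k \<in> {1..n+1}" "\<zeta> k = None" by blast
  have eq: "\<zeta> i = None \<longleftrightarrow> i = k" if "i \<in> {1..n+1}" for i
    using inj_onD[OF assms, of i k] k that by auto
  have "i \<in> finite_marks n \<zeta> \<longleftrightarrow> i \<in> {1..n+1} - {k}" for i
    using eq[of i] unfolding finite_marks_def mem_Collect_eq Diff_iff singleton_iff by metis
  then have "finite_marks n \<zeta> = {1..n+1} - {k}"
    by (rule set_eqI)
  then show ?thesis using k by simp
next
  case False
  then have "finite_marks n \<zeta> = {1..n+1}"
    by (auto simp: finite_marks_def)
  then show ?thesis by simp
qed

lemma driving_field_eq_drift:
  "driving_field n \<zeta> \<nu> x g j t = drift {1..2*n} (finite_marks n \<zeta>) (\<lambda>j. complex_of_real (x j t))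
     (\<lambda>k. g t (the (\<zeta> k))) (\<lambda>j. complex_of_real (\<nu> j t)) j"
proof -
  have "(\<Sum>k=1..n+1. 4 * recip_diff (complex_of_real (x j t)) (map_option (g t) (\<zeta> k))) =
      (\<Sum>k\<in>finite_marks n \<zeta>. 4 * recip_diff (complex_of_real (x j t)) (map_option (g t) (\<zeta> k)))"
    by (rule sum.mono_neutral_right) (auto simp: finite_marks_def recip_diff_def)
  also have "\<dots> = (\<Sum>k\<in>finite_marks n \<zeta>. 4 / (complex_of_real (x j t) - g t (the (\<zeta> k))))"
    by (intro sum.cong refl) (auto simp: finite_marks_def recip_diff_def)
  finally show ?thesis
    by (simp add: driving_field_def drift_def)
qed

text \<open>The time \<open>t0\<close> is fixed throughout: constancy amounts to comparing one
  arbitrary time before the collision with time 0.\<close>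

locale superposition =
  fixes n :: nat and x0 :: "nat \<Rightarrow> real" and \<zeta> :: "nat \<Rightarrow> complex option"
    and \<nu> x :: "nat \<Rightarrow> real \<Rightarrow> real" and g :: "real \<Rightarrow> complex \<Rightarrow> complex" and t0 :: real
  assumes inj_\<zeta>: "inj_on \<zeta> {1..n+1}"
    and \<nu>_meas: "\<And>j. j \<in> {1..2*n} \<Longrightarrow> \<nu> j \<in> borel_measurable (lebesgue_on {0..})"
    and \<nu>_nonneg: "\<And>j t. j \<in> {1..2*n} \<Longrightarrow> 0 \<le> t \<Longrightarrow> 0 \<le> \<nu> j t"
    and sup: "nu_superposition n x0 \<zeta> \<nu> x g"
    and t0: "0 \<le> t0" "ereal t0 < collision_time (2*n) (n+1) \<zeta> x g"
begin

lemma no_collision: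
  assumes "t \<in> {0..t0}"
  shows "\<not> ((\<exists>j\<in>{1..2*n}. \<exists>k\<in>{1..2*n}. j \<noteq> k \<and> x j t = x k t) \<or>
    (\<exists>j\<in>{1..2*n}. \<exists>k\<in>{1..n+1}. map_option (g t) (\<zeta> k) = Some (complex_of_real (x j t))))"
  by (rule ereal_less_first_timeD[OF t0(2)[unfolded collision_time_def]]) (use assms in simp_all)

lemma driving_points_distinct:
  assumes "t \<in> {0..t0}"
  shows "inj_on (\<lambda>j. complex_of_real (x j t)) {1..2*n}"
  using no_collision[OF assms] unfolding inj_on_def of_real_eq_iff by blast

lemma mark_not_hit:
  assumes "t \<in> {0..t0}" "j \<in> {1..2*n}" "k \<in> finite_marks n \<zeta>"
  shows "g t (the (\<zeta> k)) \<noteq> complex_of_real (x j t)"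
proof
  assume "g t (the (\<zeta> k)) = complex_of_real (x j t)"
  then have "map_option (g t) (\<zeta> k) = Some (complex_of_real (x j t))" "k \<in> {1..n+1}"
    using assms(3) by (auto simp: finite_marks_def)
  with no_collision[OF assms(1)] assms(2) show False
    by metis
qed

text \<open>The swallowing of a finite mark is one of the events counted as collisions, so it cannot
  precede the collision time.\<close>

lemma mark_swallowing_time:
  assumes k: "k \<in> finite_marks n \<zeta>"
  shows "ereal t0 < swallowing_time (2*n) x g (the (\<zeta> k))"
proof -
  have "collision_time (2*n) (n+1) \<zeta> x g \<le> swallowing_time (2*n) x g (the (\<zeta> k))"
    unfolding collision_time_def swallowing_time_def first_time_def
    by (intro INF_superset_mono) (use k in \<open>force simp: hits_def finite_marks_def\<close>)+
  then show ?thesis using t0 by simp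
qed

lemma driving_function:
  assumes j: "j \<in> {1..2*n}"
  shows "driving_field n \<zeta> \<nu> x g j absolutely_integrable_on {0..t0}"
    and "t \<in> {0..t0} \<Longrightarrow> (driving_field n \<zeta> \<nu> x g j has_integral
      (complex_of_real (x j t) - complex_of_real (x j 0))) {0..t}"
proof -
  have sol: "solves_until (collision_time (2*n) (n+1) \<zeta> x g) (\<lambda>t. complex_of_real (x j t)) (driving_field n \<zeta> \<nu> x g j)"
    using sup j by (simp add: nu_superposition_def Let_def)
  then show "driving_field n \<zeta> \<nu> x g j absolutely_integrable_on {0..t0}"
    using t0 by (simp add: solves_until_def)
  assume "t \<in> {0..t0}"
  moreover from this have "ereal t < collision_time (2*n) (n+1) \<zeta> x g"
    using t0 by (auto intro: le_less_trans[of "ereal t" "ereal t0"])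
  ultimately show "(driving_field n \<zeta> \<nu> x g j has_integral
      (complex_of_real (x j t) - complex_of_real (x j 0))) {0..t}"
    using sol by (simp add: solves_until_def)
qed

lemma driving_function_continuous:
  assumes j: "j \<in> {1..2*n}"
  shows "continuous_on {0..t0} (\<lambda>t. complex_of_real (x j t))"
  by (rule has_integral_continuous_on[OF t0(1) driving_function(2)[OF j]])

sublocale loewner_flow "collision_time (2*n) (n+1) \<zeta> x g" "2*n" \<nu> x g t0
proof
  show "loewner_chain_until (collision_time (2*n) (n+1) \<zeta> x g) (2*n) \<nu> x g"
    using sup by (simp add: nu_superposition_def Let_def)
  fix j assume "j \<in> {1..2*n}"
  from continuous_on_Re[OF driving_function_continuous[OF this]]
  show "continuous_on {0..t0} (x j)" by simp
qed (use t0 in auto)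

text \<open>
  Integrability of the speeds is not among the hypotheses, only that of the velocities. With \<open>2 * n\<close>
  driving points and \<open>n\<close> or \<open>n + 1\<close> finite marked points, the factor in the second-moment identity is
  \<open>-2\<close> or \<open>-6\<close>, so the sum of the speeds is a combination of velocities with continuous coefficients.
\<close>

lemma speed_integrable:
  assumes j: "j \<in> {1..2*n}"
  shows "(\<lambda>t. complex_of_real (\<nu> j t)) absolutely_integrable_on {0..t0}"
proof -
  let ?F = "finite_marks n \<zeta>"
  define C :: complex where "C = 2 * (of_nat (card {1..2*n}) - 1) - 4 * of_nat (card ?F)"
  \<comment> \<open>\<open>2 * (2 * n - 1) - 4 * n\<close> if one mark is infinite, and
    \<open>2 * (2 * n - 1) - 4 * (n + 1)\<close> otherwise.\<close>
  have "C = -2 \<or> C = -6"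
    using card_finite_marks[OF inj_\<zeta>] by (auto simp: C_def)
  then have C: "C \<noteq> 0" by auto
  define V where "V w t = (\<Sum>j=1..2*n. 2 * complex_of_real (\<nu> j t) / (g t w - complex_of_real (x j t)))" for w t
  define W where "W t = (\<Sum>j=1..2*n. complex_of_real (x j t) * driving_field n \<zeta> \<nu> x g j t) -
      2 * (\<Sum>k\<in>?F. g t (the (\<zeta> k)) * V (the (\<zeta> k)) t)" for t
  have W_eq: "W t = C * (\<Sum>j=1..2*n. complex_of_real (\<nu> j t))" if t: "t \<in> {0..t0}" for t
    unfolding W_def C_def V_def driving_field_eq_drift
    by (rule drift_second_moment) (use driving_points_distinct[OF t] mark_not_hit[OF t] in auto)
  have V: "V (the (\<zeta> k)) absolutely_integrable_on {0..t0}"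
    and Z: "continuous_on {0..t0} (\<lambda>t. g t (the (\<zeta> k)))" if "k \<in> ?F" for k
    using velocity_integrable[OF order_refl t0(1) mark_swallowing_time[OF that]]
      trajectory_continuous[OF order_refl t0(1) mark_swallowing_time[OF that]]
    unfolding V_def by auto
  have "(\<lambda>t. \<Sum>j=1..2*n. complex_of_real (x j t) * driving_field n \<zeta> \<nu> x g j t) absolutely_integrable_on {0..t0}"
    by (intro absolutely_integrable_sum finite_atLeastAtMost)
      (rule continuous_on_mult_absolutely_integrable[OF driving_function_continuous driving_function(1)])
  moreover have "(\<lambda>t. \<Sum>k\<in>?F. g t (the (\<zeta> k)) * V (the (\<zeta> k)) t) absolutely_integrable_on {0..t0}"
    by (intro absolutely_integrable_sum finite_finite_marks)
      (rule continuous_on_mult_absolutely_integrable[OF Z V])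
  ultimately have "W absolutely_integrable_on {0..t0}"
    unfolding W_def
    by (intro set_integral_diff(1) continuous_on_mult_absolutely_integrable[OF continuous_on_const])
  then have "(\<lambda>t. 1 / C * W t) absolutely_integrable_on {0..t0}"
    by (intro continuous_on_mult_absolutely_integrable continuous_on_const)
  then have "(\<lambda>t. 1 / C * W t) integrable_on {0..t0}"
    by (simp add: absolutely_integrable_on_def)
  then have "(\<lambda>t. Re (1 / C * W t)) integrable_on {0..t0}"
    by (rule integrable_linear[OF _ bounded_linear_Re, unfolded comp_def])
  then have sum_int: "(\<lambda>t. \<Sum>j=1..2*n. \<nu> j t) integrable_on {0..t0}"
    by (rule integrable_eq) (simp add: W_eq C)
  \<comment> \<open>The speeds are nonnegative, so nothing cancels in their sum, and it dominates
    each of them; together with measurability this gives integrability of each.\<close>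
  show ?thesis
  proof (rule measurable_bounded_by_integrable_imp_absolutely_integrable[OF _ _ sum_int])
    have "\<nu> j \<in> borel_measurable (lebesgue_on {0..t0})"
      by (rule measurable_restrict_mono[OF \<nu>_meas[OF j]]) auto
    then show "(\<lambda>t. complex_of_real (\<nu> j t)) \<in> borel_measurable (lebesgue_on {0..t0})"
      by (rule measurable_compose[OF _ borel_measurable_of_real])
    show "norm (complex_of_real (\<nu> j t)) \<le> (\<Sum>j=1..2*n. \<nu> j t)" if "t \<in> {0..t0}" for t
      using member_le_sum[OF j, of "\<lambda>j. \<nu> j t"] \<nu>_nonneg that j by auto
  qed auto
qed

sublocale integrable_loewner_flow "collision_time (2*n) (n+1) \<zeta> x g" "2*n" \<nu> x g t0
  by unfold_locales (rule speed_integrable)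

text \<open>If \<open>z\<close> is a mark, both sides are \<open>None\<close>. Otherwise the value
  at \<open>t0\<close> is the value at 0 times the exponential of an integral whose integrand
  vanishes at every time.\<close>

lemma motion_integral_eq_initial:
  assumes z: "ereal t0 < swallowing_time (2*n) x g z"
  shows "motion_integral n \<zeta> x g t0 z = motion_integral n \<zeta> x g 0 z"
proof (cases "Some z \<in> \<zeta> ` {1..n+1}")
  case True
  then show ?thesis by (simp add: motion_integral_def)
next
  case False
  let ?J = "{1..2*n}" and ?F = "finite_marks n \<zeta>"
  define A where "A t = (\<Sum>j=1..2*n. 2 * complex_of_real (\<nu> j t) *
    (1 / (g t z - complex_of_real (x j t)) * (1 / (g t z - complex_of_real (x j t)))))" for t
  \<comment> \<open>The logarithmic time derivative of \<open>g t z - x j t\<close>: the velocity of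
    the trajectory minus that of the driving point, divided by their difference.\<close>
  define B where "B j t = ((\<Sum>i=1..2*n. 2 * complex_of_real (\<nu> i t) * (1 / (g t z - complex_of_real (x i t)))) -
    driving_field n \<zeta> \<nu> x g j t) / (g t z - complex_of_real (x j t))" for j t
  define K where "K k t = (\<Sum>j=1..2*n. 2 * complex_of_real (\<nu> j t) *
    (1 / (g t z - complex_of_real (x j t)) * (1 / (g t (the (\<zeta> k)) - complex_of_real (x j t)))))" for k t
  have deriv_eq: "deriv (g t0) z = exp (- integral {0..t0} A)"
    unfolding A_def by (rule DERIV_imp_deriv[OF spatial_derivative[OF z]])
  have A: "A absolutely_integrable_on {0..t0}"
    unfolding A_def by (rule difference_formula(1)[OF t0(1) order_refl z z])
  have K: "K k absolutely_integrable_on {0..t0}"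
    and K_eq: "g t0 z - g t0 (the (\<zeta> k)) = (z - the (\<zeta> k)) * exp (- integral {0..t0} (K k))"
    if "k \<in> ?F" for k
    unfolding K_def using difference_formula[OF t0(1) order_refl z mark_swallowing_time[OF that]] by auto
  have V: "(\<lambda>t. \<Sum>i=1..2*n. 2 * complex_of_real (\<nu> i t) * (1 / (g t z - complex_of_real (x i t))))
      absolutely_integrable_on {0..t0}"
    using velocity_integrable[OF order_refl t0(1) z] by simp
  have B: "B j absolutely_integrable_on {0..t0}"
    and B_eq: "g t0 z - complex_of_real (x j t0) = (z - complex_of_real (x j 0)) * exp (integral {0..t0} (B j))"
    if j: "j \<in> ?J" for j
  proof -
    have f: "(\<lambda>t. (\<Sum>i=1..2*n. 2 * complex_of_real (\<nu> i t) * (1 / (g t z - complex_of_real (x i t)))) -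
        driving_field n \<zeta> \<nu> x g j t) absolutely_integrable_on {0..t0}"
      by (intro set_integral_diff V driving_function j)
    have y: "((\<lambda>t. (\<Sum>i=1..2*n. 2 * complex_of_real (\<nu> i t) * (1 / (g t z - complex_of_real (x i t)))) -
        driving_field n \<zeta> \<nu> x g j t) has_integral
        (g t z - complex_of_real (x j t) - (g 0 z - complex_of_real (x j 0)))) {0..t}"
      if t: "t \<in> {0..t0}" for t
      using has_integral_diff[OF trajectory[OF order_refl t0(1) z t] driving_function(2)[OF j t]]
      by (simp add: algebra_simps)
    have nz: "g t z - complex_of_real (x j t) \<noteq> 0" if "t \<in> {0..t0}" for t
      using not_hit[OF order_refl t0(1) z that j] by simp
    show "B j absolutely_integrable_on {0..t0}"
      unfolding B_def by (rule log_derivative_exp(1)[OF t0(1) f y nz])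
    show "g t0 z - complex_of_real (x j t0) = (z - complex_of_real (x j 0)) * exp (integral {0..t0} (B j))"
      unfolding B_def
      using log_derivative_exp(2)[where y = "\<lambda>t. g t z - complex_of_real (x j t)", OF t0(1) f y nz] by simp
  qed
  \<comment> \<open>Each coefficient is integrable on its own, so the exponents may be merged under
    one integral, where the pointwise identity applies.\<close>
  have "integral {0..t0} (\<lambda>t. - A t + (\<Sum>j\<in>?J. B j t) + 2 * (\<Sum>k\<in>?F. K k t)) =
      - integral {0..t0} A + (\<Sum>j\<in>?J. integral {0..t0} (B j)) + 2 * (\<Sum>k\<in>?F. integral {0..t0} (K k))"
    using A B K unfolding absolutely_integrable_on_def
    by (intro integral_unique has_integral_add has_integral_neg has_integral_sum has_integral_mult_right
      integrable_integral) auto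
  moreover have "integral {0..t0} (\<lambda>t. - A t + (\<Sum>j\<in>?J. B j t) + 2 * (\<Sum>k\<in>?F. K k t)) =
      integral {0..t0} (\<lambda>t. 0)"
  proof (rule Henstock_Kurzweil_Integration.integral_cong)
    fix t assume t: "t \<in> {0..t0}"
    show "- A t + (\<Sum>j\<in>?J. B j t) + 2 * (\<Sum>k\<in>?F. K k t) = 0"
      unfolding A_def B_def K_def driving_field_eq_drift
      by (rule log_derivative_cancels)
        (use driving_points_distinct[OF t] mark_not_hit[OF t] not_hit[OF order_refl t0(1) z t] in auto)
  qed
  ultimately have zero: "- integral {0..t0} A + (\<Sum>j\<in>?J. integral {0..t0} (B j)) +
      2 * (\<Sum>k\<in>?F. integral {0..t0} (K k)) = 0" by simp
  have sq: "(exp (- u))\<^sup>2 = exp (- (2 * u))" for u :: complex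
    by (simp flip: exp_double)
  have prod_x: "(\<Prod>j=1..2*n. (z - complex_of_real (x j 0)) * exp (integral {0..t0} (B j))) =
      (\<Prod>j=1..2*n. z - complex_of_real (x j 0)) * exp (\<Sum>j\<in>?J. integral {0..t0} (B j))"
    by (simp add: prod.distrib exp_sum)
  have prod_\<zeta>: "(\<Prod>k\<in>?F. ((z - the (\<zeta> k)) * exp (- integral {0..t0} (K k)))\<^sup>2) =
      (\<Prod>k\<in>?F. (z - the (\<zeta> k))\<^sup>2) * exp (- (2 * (\<Sum>k\<in>?F. integral {0..t0} (K k))))"
    unfolding power_mult_distrib prod.distrib sq sum_distrib_left sum_negf[symmetric]
    by (simp only: exp_sum finite_finite_marks)
  \<comment> \<open>At time 0 the derivative factor is therefore 1, and the initial value is the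
    bare quotient of the two products.\<close>
  have g0: "g 0 = (\<lambda>z. z)" by auto
  have "deriv (g t0) z * (\<Prod>j=1..2*n. g t0 z - complex_of_real (x j t0)) /
      (\<Prod>k\<in>?F. (g t0 z - g t0 (the (\<zeta> k)))\<^sup>2) =
    exp (- integral {0..t0} A) * (\<Prod>j=1..2*n. (z - complex_of_real (x j 0)) * exp (integral {0..t0} (B j))) /
      (\<Prod>k\<in>?F. ((z - the (\<zeta> k)) * exp (- integral {0..t0} (K k)))\<^sup>2)"
    by (simp add: deriv_eq B_eq K_eq)
  also have "\<dots> = ((\<Prod>j=1..2*n. z - complex_of_real (x j 0)) / (\<Prod>k\<in>?F. (z - the (\<zeta> k))\<^sup>2)) *
      (exp (- integral {0..t0} A) * exp (\<Sum>j\<in>?J. integral {0..t0} (B j)) /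
        exp (- (2 * (\<Sum>k\<in>?F. integral {0..t0} (K k)))))"
    unfolding prod_x prod_\<zeta> by (simp only: times_divide_times_eq mult_ac)
  also have "exp (- integral {0..t0} A) * exp (\<Sum>j\<in>?J. integral {0..t0} (B j)) /
        exp (- (2 * (\<Sum>k\<in>?F. integral {0..t0} (K k)))) =
      exp (- integral {0..t0} A + (\<Sum>j\<in>?J. integral {0..t0} (B j)) + 2 * (\<Sum>k\<in>?F. integral {0..t0} (K k)))"
    by (simp only: exp_add exp_minus divide_inverse inverse_inverse_eq)
  finally show ?thesis
    using False unfolding motion_integral_def zero finite_marks_def[symmetric] by (simp add: g0)
qed

end

section \<open>Constancy on the whole time interval\<close>

theorem theorem2p7:
  fixes n :: nat
    and x0 :: "nat \<Rightarrow> real"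
    and \<zeta> :: "nat \<Rightarrow> complex option"
    and \<nu> x :: "nat \<Rightarrow> real \<Rightarrow> real"
    and g :: "real \<Rightarrow> complex \<Rightarrow> complex"
    and z :: complex
  assumes "n \<ge> 1"
    and "inj_on x0 {1..2*n}"
    and "inj_on \<zeta> {1..n+1}"
    and "map_option cnj ` \<zeta> ` {1..n+1} \<subseteq> \<zeta> ` {1..n+1}"
    and "\<And>j. j \<in> {1..2*n} \<Longrightarrow> \<nu> j \<in> borel_measurable (lebesgue_on {0..})"
    and "\<And>j t. j \<in> {1..2*n} \<Longrightarrow> 0 \<le> t \<Longrightarrow> 0 \<le> \<nu> j t"
    and "nu_superposition n x0 \<zeta> \<nu> x g"
    and "0 \<le> Im z"
  shows "(\<lambda>t. motion_integral n \<zeta> x g t z) constant_on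
    {t. 0 \<le> t \<and> ereal t < min (swallowing_time (2*n) x g z) (collision_time (2*n) (n+1) \<zeta> x g)}"
  unfolding constant_on_def
\<comment> \<open>The constant, left open here, becomes the value at time 0. If \<open>z\<close> is
  a driving point at time 0, the set of times is empty.\<close>
proof (intro exI ballI)
  fix t assume "t \<in> {t. 0 \<le> t \<and> ereal t < min (swallowing_time (2*n) x g z) (collision_time (2*n) (n+1) \<zeta> x g)}"
  then have t: "0 \<le> t" "ereal t < swallowing_time (2*n) x g z" "ereal t < collision_time (2*n) (n+1) \<zeta> x g"
    by auto
  interpret superposition n x0 \<zeta> \<nu> x g t
    by unfold_locales (fact assms t)+
  show "motion_integral n \<zeta> x g t z = motion_integral n \<zeta> x g 0 z"
    by (rule motion_integral_eq_initial[OF t(2)])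
qed

end
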